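(* Let $S=\{321,231\}$. Then $f_S(0,x)=1$ and, for $n\ge1$, $$f_S(n,x)=f_S(n-1,x)+\sum_{i=1}^{n-1}x^{n-i-1}f_S(i-1,x).$$ Moreover, for $n\ge0$, $$f_S(n+2,x)=(x+1)f_S(n+1,x)-(x-1)f_S(n,x),$$ where $f_S(0,x)=1$, $f_S(1,x)=1$ and $f_S(2,x)=2$.
   Context: $\mathfrak S_n$ is the set of permutations of $\{1,\dots,n\}$. $\operatorname{Av}_n(S)$ is the set of $\pi\in\mathfrak S_n$ having no subsequence order-isomorphic to any element of $S$. $\operatorname{DD}(\pi)$ is the number of indices $k$ with $\pi(k)<k<\pi^{-1}(k)$ (double deficiencies), and $f_S(n,x)=\sum_{\pi\in\operatorname{Av}_n(S)}x^{\operatorname{DD}(\pi)}$. *)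

theory Defs
  imports "HOL-Combinatorics.Permutations" "HOL-Library.Sublist"
begin

text \<open>Patterns are given in one-line notation, so that 321 is \<open>[3, 2, 1]\<close>.\<close>

definition one_line :: "nat \<Rightarrow> (nat \<Rightarrow> nat) \<Rightarrow> nat list" where
  "one_line n \<pi> = map \<pi> [1..<Suc n]"

definition order_isomorphic :: "nat list \<Rightarrow> nat list \<Rightarrow> bool" where
  "order_isomorphic u v \<longleftrightarrow> length u = length v \<and>
     (\<forall>i < length u. \<forall>j < length u. u ! i < u ! j \<longleftrightarrow> v ! i < v ! j)"

text \<open>Here \<^const>\<open>subseq\<close> is the library's relation of being a not necessarily contiguous
  subsequence of a list.\<close>

definition Av :: "nat \<Rightarrow> nat list set \<Rightarrow> (nat \<Rightarrow> nat) set" where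
  "Av n S = {\<pi>. \<pi> permutes {1..n} \<and>
     \<not> (\<exists>\<sigma>\<in>S. \<exists>w. subseq w (one_line n \<pi>) \<and> order_isomorphic w \<sigma>)}"

definition DD :: "nat \<Rightarrow> (nat \<Rightarrow> nat) \<Rightarrow> nat" where
  "DD n \<pi> = card {k \<in> {1..n}. \<pi> k < k \<and> k < inv \<pi> k}"

text \<open>The variable \<open>x\<close> ranges over an arbitrary commutative ring; taking \<open>x = [:0, 1:]\<close> in the type
  of integer polynomials gives the generating polynomial itself.\<close>

definition dd_gf :: "nat list set \<Rightarrow> nat \<Rightarrow> 'a::comm_ring_1 \<Rightarrow> 'a" where
  "dd_gf S n x = (\<Sum>\<pi>\<in>Av n S. x ^ DD n \<pi>)"

end

theory Submission
  imports Defs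
begin

text \<open>
  A permutation avoids both 321 and 231 exactly when no entry has two larger entries on its left.
  Suppose that \<open>\<pi>\<close> is such a permutation of \<open>{1..n}\<close> with \<open>n \<ge> 1\<close>, and let \<open>j\<close> be the position of the
  entry \<open>n\<close>. Every entry to the right of \<open>n\<close> already has \<open>n\<close> as a larger entry on its left, hence
  exceeds all the other entries on its left. So the word of \<open>\<pi>\<close> is
  \<open>\<sigma>(1) ... \<sigma>(j - 1) n j (j + 1) ... (n - 1)\<close>
  where \<open>\<sigma>\<close> is an avoiding permutation of \<open>{1..j - 1}\<close> (\<open>Av_entry_after_max\<close>, \<open>Av_decompose\<close>), and
  conversely every choice of \<open>j\<close> and \<open>\<sigma>\<close> gives an avoiding permutation. This is a bijection
  (\<open>Av_bij_betw\<close>). The double deficiencies of \<open>\<pi>\<close> are those of \<open>\<sigma>\<close> together with the positions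
  \<open>k\<close> with \<open>j < k < n\<close> (\<open>DD_tail_cycle_comp\<close>). Summing over \<open>j\<close>, with \<open>j = n\<close> contributing the term
  for \<open>n - 1\<close>, gives the first recurrence.

  The sum in that recurrence is a convolution with powers of \<open>x\<close>. The one for \<open>n + 2\<close> is \<open>x\<close> times
  the one for \<open>n + 1\<close> plus a single new term, and eliminating the sum leaves the three-term
  recurrence.
\<close>

section \<open>Avoidance in terms of positions\<close>

lemma subseq_Cons_iff_nth:
  "subseq (a # w) xs \<longleftrightarrow> (\<exists>i < length xs. xs ! i = a \<and> subseq w (drop (Suc i) xs))"
proof
  assume "subseq (a # w) xs"
  then obtain us vs where "xs = us @ a # vs" "subseq w vs"
    by (auto dest: list_emb_ConsD)
  then show "\<exists>i < length xs. xs ! i = a \<and> subseq w (drop (Suc i) xs)"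
    by (intro exI[of _ "length us"]) auto
next
  assume "\<exists>i < length xs. xs ! i = a \<and> subseq w (drop (Suc i) xs)"
  then obtain i where i: "i < length xs" "xs ! i = a" "subseq w (drop (Suc i) xs)"
    by blast
  have "subseq (a # w) (drop i xs)"
    using i by (simp add: Cons_nth_drop_Suc[symmetric])
  then show "subseq (a # w) xs"
    using subseq_drop_many list_emb_suffix suffix_drop by blast
qed

lemma subseq_three_iff_nth:
  "subseq [a, b, c] xs \<longleftrightarrow>
     (\<exists>i j k. i < j \<and> j < k \<and> k < length xs \<and> xs ! i = a \<and> xs ! j = b \<and> xs ! k = c)"
  (is "?L \<longleftrightarrow> ?R")
proof
  assume ?L
  then obtain i j k where
    "i < length xs" "xs ! i = a"
    "j < length (drop (Suc i) xs)" "drop (Suc i) xs ! j = b"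
    "k < length (drop (Suc j) (drop (Suc i) xs))" "drop (Suc j) (drop (Suc i) xs) ! k = c"
    by (auto simp: subseq_Cons_iff_nth)
  then show ?R
    by (intro exI[of _ i] exI[of _ "Suc i + j"] exI[of _ "Suc i + (Suc j + k)"])
      (auto simp: add_ac)
next
  assume ?R
  then obtain i j k where *: "i < j" "j < k" "k < length xs" "xs ! i = a" "xs ! j = b" "xs ! k = c"
    by blast
  have "subseq [c] (drop (Suc j) xs)"
    unfolding subseq_Cons_iff_nth using *
    by (intro exI[of _ "k - Suc j"]) auto
  then have "subseq [b, c] (drop (Suc i) xs)"
    unfolding subseq_Cons_iff_nth[of b] using *
    by (intro exI[of _ "j - Suc i"]) auto
  then show ?L
    unfolding subseq_Cons_iff_nth[of a] using *
    by (intro exI[of _ i]) auto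
qed

lemma order_isomorphic_321_or_231:
  "order_isomorphic w [3, 2, 1] \<or> order_isomorphic w [2, 3, 1] \<longleftrightarrow>
     (\<exists>a b c. w = [a, b, c] \<and> c < a \<and> c < b \<and> a \<noteq> b)"
proof (cases "\<exists>a b c. w = [a, b, c]")
  case True
  then obtain a b c where w: "w = [a, b, c]"
    by blast
  have three: "(\<forall>i < Suc (Suc (Suc 0)). P i) \<longleftrightarrow> P 0 \<and> P 1 \<and> P 2" for P :: "nat \<Rightarrow> bool"
    by (simp add: All_less_Suc eval_nat_numeral conj_ac)
  show ?thesis
    unfolding w order_isomorphic_def
    by (simp add: three) linarith
next
  case False
  moreover have "length w \<noteq> 3"
    using False by (auto simp: length_Suc_conv eval_nat_numeral)
  ultimately show ?thesis
    by (auto simp: order_isomorphic_def)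
qed

text \<open>In both 321 and 231 the last entry is the smallest, and the two patterns together allow
  either order of the two entries before it.\<close>

lemma Av_321_231_iff:
  "\<pi> \<in> Av n {[3, 2, 1], [2, 3, 1]} \<longleftrightarrow>
     \<pi> permutes {1..n} \<and>
     \<not> (\<exists>h i k. 1 \<le> h \<and> h < i \<and> i < k \<and> k \<le> n \<and> \<pi> k < \<pi> h \<and> \<pi> k < \<pi> i)"
proof (cases "\<pi> permutes {1..n}")
  case True
  have nth: "one_line n \<pi> ! i = \<pi> (Suc i)" if "i < n" for i
    using that by (simp add: one_line_def del: upt_Suc)
  have len: "length (one_line n \<pi>) = n"
    by (simp add: one_line_def)
  have "(\<exists>\<sigma>\<in>{[3, 2, 1], [2, 3, 1]}. \<exists>w. subseq w (one_line n \<pi>) \<and> order_isomorphic w \<sigma>) \<longleftrightarrow>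
      (\<exists>w. subseq w (one_line n \<pi>) \<and>
        (order_isomorphic w [3, 2, 1] \<or> order_isomorphic w [2, 3, 1]))"
    by auto
  also have "\<dots> \<longleftrightarrow> (\<exists>a b c. subseq [a, b, c] (one_line n \<pi>) \<and> c < a \<and> c < b \<and> a \<noteq> b)"
    unfolding order_isomorphic_321_or_231 by auto
  also have "\<dots> \<longleftrightarrow> (\<exists>h i k. h < i \<and> i < k \<and> k < n \<and>
      \<pi> (Suc k) < \<pi> (Suc h) \<and> \<pi> (Suc k) < \<pi> (Suc i))" (is "?L \<longleftrightarrow> ?R")
  proof
    assume ?L
    then show ?R
      unfolding subseq_three_iff_nth len using nth by (metis less_trans)
  next
    assume ?R
    then obtain h i k where *: "h < i" "i < k" "k < n"
      "\<pi> (Suc k) < \<pi> (Suc h)" "\<pi> (Suc k) < \<pi> (Suc i)"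
      by blast
    have "subseq [\<pi> (Suc h), \<pi> (Suc i), \<pi> (Suc k)] (one_line n \<pi>)"
      unfolding subseq_three_iff_nth len using *
      by (intro exI[of _ h] exI[of _ i] exI[of _ k]) (simp add: nth)
    moreover have "\<pi> (Suc h) \<noteq> \<pi> (Suc i)"
      using permutes_inj[OF True] * by (simp add: inj_eq)
    ultimately show ?L
      using * by blast
  qed
  also have "\<dots> \<longleftrightarrow> (\<exists>h i k. 1 \<le> h \<and> h < i \<and> i < k \<and> k \<le> n \<and> \<pi> k < \<pi> h \<and> \<pi> k < \<pi> i)"
    (is "?L \<longleftrightarrow> ?R")
  proof
    assume ?L
    then obtain h i k where
      "h < i" "i < k" "k < n" "\<pi> (Suc k) < \<pi> (Suc h)" "\<pi> (Suc k) < \<pi> (Suc i)"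
      by blast
    then show ?R
      by (intro exI[of _ "Suc h"] exI[of _ "Suc i"] exI[of _ "Suc k"]) auto
  next
    assume ?R
    then obtain h i k where "1 \<le> h" "h < i" "i < k" "k \<le> n" "\<pi> k < \<pi> h" "\<pi> k < \<pi> i"
      by blast
    then show ?L
      by (intro exI[of _ "h - 1"] exI[of _ "i - 1"] exI[of _ "k - 1"]) auto
  qed
  finally show ?thesis
    using True unfolding Av_def by (simp only: mem_Collect_eq)
qed (simp add: Av_def)

lemma finite_Av: "finite (Av n S)"
  by (rule finite_subset[OF _ finite_permutations[of "{1..n}"]]) (auto simp: Av_def)


section \<open>Decomposition at the largest entry\<close>

text \<open>On \<open>{j..n}\<close> this is the cycle with one-line notation \<open>n, j, j + 1, ..., n - 1\<close>. As a factor it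
  presents \<open>\<pi>\<close> as a composition of permutations, whence that \<open>\<pi>\<close> is a permutation and that \<open>\<sigma>\<close> can be
  recovered from it both follow from general facts.\<close>

definition tail_cycle :: "nat \<Rightarrow> nat \<Rightarrow> nat \<Rightarrow> nat" where
  "tail_cycle j n k = (if k = j then n else if j < k \<and> k \<le> n then k - 1 else k)"

lemma tail_cycle_permutes:
  assumes "j \<le> n"
  shows "tail_cycle j n permutes {j..n}"
  unfolding permutes_def
proof (intro conjI allI impI)
  fix y
  show "\<exists>!k. tail_cycle j n k = y"
  proof (rule ex1I)
    show "tail_cycle j n (if y = n then j else if j \<le> y \<and> y < n then Suc y else y) = y"
      using assms by (auto simp: tail_cycle_def)
  qed (use assms in \<open>auto simp: tail_cycle_def split: if_splits\<close>)
qed (use assms in \<open>auto simp: tail_cycle_def\<close>)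

context
  fixes n j :: nat and \<sigma> :: "nat \<Rightarrow> nat"
  assumes j: "1 \<le> j" "j \<le> n" and \<sigma>: "\<sigma> permutes {1..j - 1}"
begin

lemma tail_cycle_comp_apply:
  "(tail_cycle j n \<circ> \<sigma>) k = (if k < j then \<sigma> k else tail_cycle j n k)"
proof (cases "k < j")
  case True
  then have "\<sigma> k < j"
    using permutes_in_image[OF \<sigma>, of k] permutes_not_in[OF \<sigma>, of k] j
    by (cases "k = 0") auto
  then show ?thesis
    using True by (simp add: tail_cycle_def)
next
  case False
  then show ?thesis
    using permutes_not_in[OF \<sigma>, of k] j by simp
qed

lemma tail_cycle_comp_permutes: "(tail_cycle j n \<circ> \<sigma>) permutes {1..n}"
proof (rule permutes_compose)
  show "\<sigma> permutes {1..n}"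
    using \<sigma> by (rule permutes_subset) (use j in auto)
  show "tail_cycle j n permutes {1..n}"
    using tail_cycle_permutes[OF j(2)] by (rule permutes_subset) (use j in auto)
qed

text \<open>The entry \<open>k - 1\<close> at a position \<open>k\<close> after \<open>j\<close> has only the entry \<open>n\<close> larger than it on its
  left, so the tail creates no forbidden pattern.\<close>

lemma tail_cycle_comp_in_Av_iff:
  "tail_cycle j n \<circ> \<sigma> \<in> Av n {[3, 2, 1], [2, 3, 1]} \<longleftrightarrow> \<sigma> \<in> Av (j - 1) {[3, 2, 1], [2, 3, 1]}"
proof -
  have small: "\<sigma> k < j" if "k < j" for k
    using that permutes_in_image[OF \<sigma>, of k] permutes_not_in[OF \<sigma>, of k] j
    by (cases "k = 0") auto
  have "(1 \<le> h \<and> h < i \<and> i < k \<and> k \<le> n \<and> (tail_cycle j n \<circ> \<sigma>) k < (tail_cycle j n \<circ> \<sigma>) h \<and>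
        (tail_cycle j n \<circ> \<sigma>) k < (tail_cycle j n \<circ> \<sigma>) i) \<longleftrightarrow>
      (1 \<le> h \<and> h < i \<and> i < k \<and> k \<le> j - 1 \<and> \<sigma> k < \<sigma> h \<and> \<sigma> k < \<sigma> i)" for h i k
    unfolding tail_cycle_comp_apply using small[of h] small[of i] j
    by (auto simp: tail_cycle_def)
  then show ?thesis
    unfolding Av_321_231_iff using tail_cycle_comp_permutes \<sigma> by blast
qed

text \<open>A position \<open>k\<close> with \<open>j < k < n\<close> is sent to \<open>k - 1\<close> and is the image of \<open>k + 1\<close>, so it is a double
  deficiency. The positions \<open>j\<close> and \<open>n\<close> are not, since \<open>j\<close> is sent to \<open>n\<close> and \<open>j \<le> n\<close>.\<close>

lemma DD_tail_cycle_comp: "DD n (tail_cycle j n \<circ> \<sigma>) = (n - j - 1) + DD (j - 1) \<sigma>"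
proof -
  let ?\<pi> = "tail_cycle j n \<circ> \<sigma>"
  note inv_eq = permutes_inv_eq[OF tail_cycle_comp_permutes]
  have inv_small: "inv \<sigma> k < j" if "k < j" for k
    using that permutes_in_image[OF permutes_inv[OF \<sigma>], of k]
      permutes_not_in[OF permutes_inv[OF \<sigma>], of k] j
    by (cases "k = 0") auto
  have inv_less: "inv ?\<pi> k = inv \<sigma> k" if "k < j" for k
    unfolding inv_eq tail_cycle_comp_apply
    using inv_small[OF that] permutes_inverses(1)[OF \<sigma>] by simp
  have inv_mid: "inv ?\<pi> k = k + 1" if "j \<le> k" "k < n" for k
    unfolding inv_eq tail_cycle_comp_apply using that by (simp add: tail_cycle_def)
  have inv_n: "inv ?\<pi> n = j"
    unfolding inv_eq tail_cycle_comp_apply by (simp add: tail_cycle_def)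
  have "k \<in> {1..n} \<and> ?\<pi> k < k \<and> k < inv ?\<pi> k \<longleftrightarrow>
      k \<in> {j<..<n} \<or> k \<in> {1..j - 1} \<and> \<sigma> k < k \<and> k < inv \<sigma> k" for k
  proof (cases "k < j")
    case True
    then show ?thesis
      using j by (auto simp: inv_less tail_cycle_comp_apply simp del: o_apply)
  next
    case False
    consider "k < n" | "k = n" | "n < k" by linarith
    then show ?thesis
      using False j
      by cases (auto simp: inv_mid inv_n tail_cycle_comp_apply tail_cycle_def simp del: o_apply)
  qed
  then have "{k \<in> {1..n}. ?\<pi> k < k \<and> k < inv ?\<pi> k} =
      {j<..<n} \<union> {k \<in> {1..j - 1}. \<sigma> k < k \<and> k < inv \<sigma> k}"
    by blast
  then have "DD n ?\<pi> = card ({j<..<n} \<union> {k \<in> {1..j - 1}. \<sigma> k < k \<and> k < inv \<sigma> k})"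
    unfolding DD_def by (rule arg_cong)
  also have "\<dots> = card {j<..<n} + card {k \<in> {1..j - 1}. \<sigma> k < k \<and> k < inv \<sigma> k}"
    by (rule card_Un_disjoint) auto
  finally show ?thesis
    by (simp add: DD_def)
qed

end

text \<open>An entry \<open>\<pi> k\<close> after \<open>n\<close> already has one larger entry on its left, so every other entry on
  its left is smaller. The same holds for the entries after \<open>k\<close>, so \<open>\<pi> k\<close> exceeds precisely the
  entries at the \<open>k - 2\<close> earlier positions other than that of \<open>n\<close>.\<close>

lemma Av_entry_after_max:
  assumes \<pi>: "\<pi> \<in> Av n {[3, 2, 1], [2, 3, 1]}"
    and j: "1 \<le> j" "\<pi> j = n" and k: "j < k" "k \<le> n"
  shows "\<pi> k = k - 1"
proof -
  have perm: "\<pi> permutes {1..n}"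
    and av: "\<And>h i k. 1 \<le> h \<Longrightarrow> h < i \<Longrightarrow> i < k \<Longrightarrow> k \<le> n \<Longrightarrow> \<not> (\<pi> k < \<pi> h \<and> \<pi> k < \<pi> i)"
    using \<pi> unfolding Av_321_231_iff by blast+
  have inj: "\<pi> a = \<pi> b \<longleftrightarrow> a = b" for a b
    using permutes_inj[OF perm] by (simp add: inj_eq)
  have range: "1 \<le> \<pi> i \<and> \<pi> i \<le> n" if "1 \<le> i" "i \<le> n" for i
    using permutes_in_image[OF perm, of i] that by simp
  have less_n: "\<pi> i < n" if "1 \<le> i" "i \<le> n" "i \<noteq> j" for i
    using range[OF that(1,2)] inj[of i j] that(3) j by auto
  have left_less: "\<pi> i < \<pi> m" if "j < m" "m \<le> n" "1 \<le> i" "i < m" "i \<noteq> j" for i m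
  proof (rule ccontr)
    assume "\<not> \<pi> i < \<pi> m"
    then have "\<pi> m < \<pi> i"
      using inj[of i m] that by auto
    moreover have "\<pi> m < \<pi> j"
      using less_n[of m] that j by auto
    ultimately show False
      using av[of i j m] av[of j i m] that j by (cases "i < j") auto
  qed
  have "{1..<\<pi> k} = \<pi> ` ({1..<k} - {j})"
  proof (intro equalityI subsetI)
    fix v assume v: "v \<in> {1..<\<pi> k}"
    then have "v \<in> \<pi> ` {1..n}"
      using permutes_image[OF perm] range[of k] k j by auto
    then obtain i where i: "v = \<pi> i" "1 \<le> i" "i \<le> n" by auto
    have "i \<noteq> j"
      using v i(1) j less_n[of k] k by auto
    moreover have "i < k"
    proof (rule ccontr)
      assume "\<not> i < k"
      then show False
        using left_less[of i k] i k j v by (cases "i = k") auto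
    qed
    ultimately show "v \<in> \<pi> ` ({1..<k} - {j})"
      using i by auto
  next
    fix v assume "v \<in> \<pi> ` ({1..<k} - {j})"
    then show "v \<in> {1..<\<pi> k}"
      using left_less[of k] range k by fastforce
  qed
  then have "card {1..<\<pi> k} = card ({1..<k} - {j})"
    by (metis card_image inj inj_onI)
  then have "\<pi> k - 1 = k - 1 - 1"
    using j k by simp
  then show ?thesis
    using range[of k] j k by linarith
qed

text \<open>The prefix \<open>\<sigma>\<close> is recovered by undoing the cycle, which leaves a permutation fixing every
  position from \<open>j\<close> on.\<close>

lemma Av_decompose:
  assumes \<pi>: "\<pi> \<in> Av n {[3, 2, 1], [2, 3, 1]}" and "1 \<le> n"
  obtains j \<sigma> where "j \<in> {1..n}" "\<sigma> \<in> Av (j - 1) {[3, 2, 1], [2, 3, 1]}"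
    "\<pi> = tail_cycle j n \<circ> \<sigma>"
proof -
  have perm: "\<pi> permutes {1..n}"
    using \<pi> by (simp add: Av_def)
  have "n \<in> \<pi> ` {1..n}"
    using permutes_image[OF perm] \<open>1 \<le> n\<close> by simp
  then obtain j where j: "1 \<le> j" "j \<le> n" "\<pi> j = n"
    by auto
  define \<sigma> where "\<sigma> = inv (tail_cycle j n) \<circ> \<pi>"
  have cycle: "tail_cycle j n permutes {1..n}"
    using tail_cycle_permutes[OF j(2)] by (rule permutes_subset) (use j in auto)
  have tail: "\<pi> k = tail_cycle j n k" if "j \<le> k" "k \<le> n" for k
    using that j Av_entry_after_max[OF \<pi> j(1,3)] by (cases "k = j") (auto simp: tail_cycle_def)
  have "\<sigma> permutes {1..j - 1}"
  proof (rule permutes_superset)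
    show "\<sigma> permutes {1..n}"
      unfolding \<sigma>_def by (intro permutes_compose perm permutes_inv cycle)
    show "\<sigma> k = k" if "k \<in> {1..n} - {1..j - 1}" for k
      using that tail[of k] permutes_inverses(2)[OF cycle] by (auto simp: \<sigma>_def)
  qed
  moreover have "\<pi> = tail_cycle j n \<circ> \<sigma>"
    by (auto simp: \<sigma>_def permutes_inverses(1)[OF cycle])
  ultimately show ?thesis
    using that[of j \<sigma>] j \<pi> tail_cycle_comp_in_Av_iff by auto
qed

text \<open>Disjointness of the pieces and injectivity on each of them: the position \<open>j\<close> of the entry \<open>n\<close>
  is determined by the composite, and the cycle is then cancelled.\<close>

lemma Av_bij_betw:
  assumes "1 \<le> n"
  shows "bij_betw (\<lambda>(j, \<sigma>). tail_cycle j n \<circ> \<sigma>)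
    (SIGMA j:{1..n}. Av (j - 1) {[3, 2, 1], [2, 3, 1]}) (Av n {[3, 2, 1], [2, 3, 1]})"
proof (rule bij_betw_imageI)
  show "inj_on (\<lambda>(j, \<sigma>). tail_cycle j n \<circ> \<sigma>) (SIGMA j:{1..n}. Av (j - 1) {[3, 2, 1], [2, 3, 1]})"
  proof (intro inj_onI, clarify)
    fix i j \<sigma> \<tau>
    assume i: "i \<in> {1..n}" "\<sigma> \<in> Av (i - 1) {[3, 2, 1], [2, 3, 1]}"
      and j: "j \<in> {1..n}" "\<tau> \<in> Av (j - 1) {[3, 2, 1], [2, 3, 1]}"
      and eq: "tail_cycle i n \<circ> \<sigma> = tail_cycle j n \<circ> \<tau>"
    have \<sigma>: "\<sigma> permutes {1..i - 1}" and \<tau>: "\<tau> permutes {1..j - 1}"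
      using i j by (auto simp: Av_def)
    have "(tail_cycle i n \<circ> \<sigma>) i = n" "(tail_cycle j n \<circ> \<tau>) j = n"
      using i(1) j(1) \<sigma> \<tau> by (simp_all add: tail_cycle_comp_apply tail_cycle_def del: o_apply)
    then have "i = j"
      using permutes_inj[OF tail_cycle_comp_permutes[of i n \<sigma>]] i(1) \<sigma> eq
      by (metis atLeastAtMost_iff injD)
    moreover have "inj (tail_cycle j n)"
      using permutes_inj tail_cycle_permutes j(1) by auto
    ultimately show "i = j \<and> \<sigma> = \<tau>"
      using eq by (simp add: fun_eq_iff inj_eq)
  qed
  show "(\<lambda>(j, \<sigma>). tail_cycle j n \<circ> \<sigma>) ` (SIGMA j:{1..n}. Av (j - 1) {[3, 2, 1], [2, 3, 1]}) =
      Av n {[3, 2, 1], [2, 3, 1]}" (is "?f ` ?A = ?B")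
  proof (intro equalityI subsetI)
    fix \<pi> assume "\<pi> \<in> ?f ` ?A"
    then obtain j \<sigma> where *: "j \<in> {1..n}" "\<sigma> \<in> Av (j - 1) {[3, 2, 1], [2, 3, 1]}"
      "\<pi> = tail_cycle j n \<circ> \<sigma>"
      by auto
    moreover have "\<sigma> permutes {1..j - 1}"
      using *(2) by (simp add: Av_def)
    ultimately show "\<pi> \<in> ?B"
      using tail_cycle_comp_in_Av_iff by simp
  next
    fix \<pi> assume "\<pi> \<in> ?B"
    then obtain j \<sigma> where "j \<in> {1..n}" "\<sigma> \<in> Av (j - 1) {[3, 2, 1], [2, 3, 1]}"
      "\<pi> = tail_cycle j n \<circ> \<sigma>"
      using assms by (rule Av_decompose)
    then show "\<pi> \<in> ?f ` ?A"
      by force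
  qed
qed


section \<open>The recurrences\<close>

lemma dd_gf_0: "dd_gf {[3, 2, 1], [2, 3, 1]} 0 x = 1"
proof -
  have "Av 0 {[3, 2, 1], [2, 3, 1]} = {id}"
    unfolding set_eq_iff Av_321_231_iff by (auto simp: permutes_empty)
  then show ?thesis
    unfolding dd_gf_def by (simp add: DD_def)
qed

lemma dd_gf_recurrence:
  fixes x :: "'a::comm_ring_1"
  assumes "1 \<le> n"
  shows "dd_gf {[3, 2, 1], [2, 3, 1]} n x = dd_gf {[3, 2, 1], [2, 3, 1]} (n - 1) x +
    (\<Sum>i = 1..n - 1. x ^ (n - i - 1) * dd_gf {[3, 2, 1], [2, 3, 1]} (i - 1) x)"
proof -
  let ?S = "{[3, 2, 1], [2, 3, 1]} :: nat list set"
  have weight: "x ^ DD n (tail_cycle j n \<circ> \<sigma>) = x ^ (n - j - 1) * x ^ DD (j - 1) \<sigma>"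
    if "j \<in> {1..n}" "\<sigma> \<in> Av (j - 1) ?S" for j \<sigma>
    using that DD_tail_cycle_comp[of j n \<sigma>] by (simp add: Av_def power_add)
  have "dd_gf ?S n x = (\<Sum>(j, \<sigma>)\<in>(SIGMA j:{1..n}. Av (j - 1) ?S). x ^ DD n (tail_cycle j n \<circ> \<sigma>))"
    unfolding dd_gf_def
    by (subst sum.reindex_bij_betw[OF Av_bij_betw[OF assms], symmetric])
      (simp add: case_prod_unfold)
  also have "\<dots> = (\<Sum>j = 1..n. \<Sum>\<sigma>\<in>Av (j - 1) ?S. x ^ DD n (tail_cycle j n \<circ> \<sigma>))"
    by (simp add: sum.Sigma finite_Av)
  also have "\<dots> = (\<Sum>j = 1..n. x ^ (n - j - 1) * dd_gf ?S (j - 1) x)"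
    unfolding dd_gf_def sum_distrib_left by (intro sum.cong refl weight)
  also have "{1..n} = insert n {1..n - 1}"
    using assms by auto
  \<comment> \<open>For \<open>j = n\<close> the truncated exponent \<open>n - j - 1\<close> is \<open>0\<close>, as the tail is then empty.\<close>
  finally show ?thesis
    using assms by (simp add: sum.insert)
qed

theorem mainTheorem8:
  fixes x :: "'a::comm_ring_1" and S :: "nat list set"
  assumes "S = {[3, 2, 1], [2, 3, 1]}"
  shows "(dd_gf S 0 x = 1 \<and>
          (\<forall>n\<ge>1. dd_gf S n x =
             dd_gf S (n - 1) x + (\<Sum>i = 1..n - 1. x ^ (n - i - 1) * dd_gf S (i - 1) x))) \<and>
         ((\<forall>n. dd_gf S (n + 2) x = (x + 1) * dd_gf S (n + 1) x - (x - 1) * dd_gf S n x) \<and>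
          dd_gf S 0 x = 1 \<and> dd_gf S 1 x = 1 \<and> dd_gf S 2 x = 2)"
proof -
  have zero: "dd_gf S 0 x = 1"
    unfolding assms by (rule dd_gf_0)
  have rec: "dd_gf S n x =
      dd_gf S (n - 1) x + (\<Sum>i = 1..n - 1. x ^ (n - i - 1) * dd_gf S (i - 1) x)"
    if "1 \<le> n" for n
    unfolding assms using that by (rule dd_gf_recurrence)
  have one: "dd_gf S 1 x = 1"
    using rec[of 1] zero by simp
  have three_term: "dd_gf S (n + 2) x = (x + 1) * dd_gf S (n + 1) x - (x - 1) * dd_gf S n x" for n
  proof -
    define A where "A = (\<Sum>i = 1..n. x ^ (n - i) * dd_gf S (i - 1) x)"
    have A: "dd_gf S (n + 1) x = dd_gf S n x + A"
      using rec[of "n + 1"] by (simp add: A_def)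
    \<comment> \<open>All summands of the sum for \<open>n + 2\<close> but the last are \<open>x\<close> times those of the sum for \<open>n + 1\<close>.\<close>
    have "(\<Sum>i = 1..n. x ^ (n + 1 - i) * dd_gf S (i - 1) x) = x * A"
      unfolding A_def sum_distrib_left by (intro sum.cong) (auto simp: Suc_diff_le mult.assoc)
    then have "dd_gf S (n + 2) x = dd_gf S (n + 1) x + (x * A + dd_gf S n x)"
      using rec[of "n + 2"] by simp
    then show ?thesis
      unfolding A by (simp add: algebra_simps)
  qed
  have "dd_gf S 2 x = 2"
    using three_term[of 0] zero one by (simp add: numeral_2_eq_2)
  then show ?thesis
    using zero rec one three_term by blast
qed

end
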